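(* Let $m,n\ge 2$, let $G_1$, $G_2$ be connected closed graphs on the vertex sets $[m]$ and $[n]$, respectively, and let $G$ be the graph on $[m+n-2]$ associated to the pair $(G_1,G_2)$. Then every maximal clique of $G$ is of the form $[a+c-1,\,b+d-2]$, where $[a,b]$ is a maximal clique of $G_1$ and $[c,d]$ is a maximal clique of $G_2$.
   Context: $[n]=\{1,\ldots,n\}$, $[a,b]=\{a,a+1,\ldots,b\}$, and all graphs are finite and simple. A clique of a graph is (the vertex set of) a complete subgraph. A graph $H$ on $[n]$ is closed if there is a labeling of its vertices such that whenever $1\le i<j<k\le n$ or $1\le k<j<i\le n$ and $\{i,j\},\{i,k\}\in E(H)$, then $\{j,k\}\in E(H)$. For connected $H$ this is equivalent to the existence of a labeling for which all maximal cliques are intervals $[a,b]\subset[n]$ (equivalently, if $\{i,j\}\in E(H)$ and $i<k<j$ then $\{i,k\},\{k,j\}\in E(H)$). Convention: a closed graph on $[n]$ is always labeled so that its maximal cliques are intervals $F_i=[a_i,b_i]$, $1\le i\le r$, with $1=a_1<a_2<\cdots<a_r<b_r=n$. The graph $G$ associated to $(G_1,G_2)$ has vertex set $[m+n-2]$ and edge set $$E(G)=\{\{i+k-1,\,j+l-2\} : i<j,\ k<l,\ \{i,j\}\in E(G_1),\ \{k,l\}\in E(G_2)\}.$$ *)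

theory Defs
  imports Main "HOL-Library.Ramsey"
begin

text \<open>
  A finite simple graph on \<open>[n]\<close> is given by its edge set, a set of two-element subsets of
  \<open>{1..n}\<close>. The predicate \<open>clique K E\<close> does not require \<open>K\<close> to consist of vertices, so
  \<open>K \<subseteq> {1..n}\<close> is added in the definition of maximal cliques.
\<close>

definition graph_on :: "nat \<Rightarrow> nat set set \<Rightarrow> bool" where
  "graph_on n E \<longleftrightarrow> E \<subseteq> [{1..n}]\<^bsup>2\<^esup>"

definition connected_on :: "nat \<Rightarrow> nat set set \<Rightarrow> bool" where
  "connected_on n E \<longleftrightarrow> (\<forall>u\<in>{1..n}. \<forall>v\<in>{1..n}. (u, v) \<in> {(x, y). {x, y} \<in> E}\<^sup>*)"

definition maximal_clique :: "nat \<Rightarrow> nat set set \<Rightarrow> nat set \<Rightarrow> bool" where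
  "maximal_clique n E K \<longleftrightarrow>
     K \<subseteq> {1..n} \<and> clique K E \<and>
     (\<forall>K'. K \<subseteq> K' \<and> K' \<subseteq> {1..n} \<and> clique K' E \<longrightarrow> K' = K)"

text \<open>In the definition of closed graphs, \<open>\<pi> i\<close> is the vertex that receives the label \<open>i\<close>.\<close>

definition closed_graph :: "nat \<Rightarrow> nat set set \<Rightarrow> bool" where
  "closed_graph n E \<longleftrightarrow>
     (\<exists>\<pi>. bij_betw \<pi> {1..n} {1..n} \<and>
       (\<forall>i j k. (1 \<le> i \<and> i < j \<and> j < k \<and> k \<le> n \<or> 1 \<le> k \<and> k < j \<and> j < i \<and> i \<le> n) \<and>
          {\<pi> i, \<pi> j} \<in> E \<and> {\<pi> i, \<pi> k} \<in> E \<longrightarrow> {\<pi> j, \<pi> k} \<in> E))"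

text \<open>
  The standing convention on the labeling of a closed graph on \<open>[n]\<close>: with the given labels,
  the maximal cliques are exactly the intervals \<open>F\<^sub>i = [a\<^sub>i, b\<^sub>i]\<close>, \<open>1 \<le> i \<le> r\<close>, where
  \<open>1 = a\<^sub>1 < \<dots> < a\<^sub>r < b\<^sub>r = n\<close>.
\<close>

definition interval_labeled :: "nat \<Rightarrow> nat set set \<Rightarrow> bool" where
  "interval_labeled n E \<longleftrightarrow>
     (\<exists>(r::nat) a b. 1 \<le> r \<and>
        {K. maximal_clique n E K} = (\<lambda>i. {a i..b i}) ` {1..r} \<and>
        a 1 = 1 \<and> strict_mono_on {1..r} a \<and> a r < b r \<and> b r = n)"

text \<open>
  The edge set of the graph on \<open>[m + n - 2]\<close> associated to \<open>G\<^sub>1\<close> (on \<open>[m]\<close>) and \<open>G\<^sub>2\<close> (on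
  \<open>[n]\<close>). Truncated subtraction is harmless: here \<open>i, k \<ge> 1\<close> and \<open>j, l \<ge> 2\<close>.
\<close>

definition assoc_edges :: "nat set set \<Rightarrow> nat set set \<Rightarrow> nat set set" where
  "assoc_edges E1 E2 =
     {{i + k - 1, j + l - 2} | i j k l. i < j \<and> k < l \<and> {i, j} \<in> E1 \<and> {k, l} \<in> E2}"

lemma graph_on_assoc_edges:
  assumes "graph_on m E1" and "graph_on n E2"
  shows "graph_on (m + n - 2) (assoc_edges E1 E2)"
proof -
  have "{i + k - 1, j + l - 2} \<in> [{1..m + n - 2}]\<^bsup>2\<^esup>"
    if "i < j" "k < l" "{i, j} \<in> E1" "{k, l} \<in> E2" for i j k l
  proof -
    have "{i, j} \<in> [{1..m}]\<^bsup>2\<^esup>" and "{k, l} \<in> [{1..n}]\<^bsup>2\<^esup>"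
      using assms that unfolding graph_on_def by blast+
    then have "1 \<le> i" "j \<le> m" "1 \<le> k" "l \<le> n"
      unfolding doubleton_in_nsets_2 atLeastAtMost_iff by blast+
    with that(1,2) show ?thesis
      unfolding doubleton_in_nsets_2 atLeastAtMost_iff by linarith
  qed
  then show ?thesis unfolding graph_on_def assoc_edges_def by blast
qed

text \<open>For a graph on \<open>[n]\<close> the convention implies closedness, witnessed by the given labels.\<close>

lemma ex_maximal_clique:
  assumes "clique K E" and "K \<subseteq> {1..n}"
  shows "\<exists>K'. K \<subseteq> K' \<and> maximal_clique n E K'"
proof -
  let ?S = "{K'. K \<subseteq> K' \<and> K' \<subseteq> {1..n} \<and> clique K' E}"
  have "finite ?S" by (rule finite_subset[of _ "Pow {1..n}"]) auto
  moreover have "K \<in> ?S" using assms by simp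
  ultimately obtain M where "M \<in> ?S" and max: "\<And>K'. K' \<in> ?S \<Longrightarrow> M \<subseteq> K' \<Longrightarrow> M = K'"
    by (elim finite_has_maximal2[THEN bexE]) auto
  then have "K \<subseteq> M" "M \<subseteq> {1..n}" "clique M E" by simp_all
  moreover have "K' = M" if "M \<subseteq> K'" "K' \<subseteq> {1..n}" "clique K' E" for K'
    using max[of K'] that \<open>K \<subseteq> M\<close> by auto
  ultimately show ?thesis unfolding maximal_clique_def by (intro exI[of _ M]) simp
qed

lemma closed_graph_if_interval_labeled:
  assumes "graph_on n E" and "interval_labeled n E"
  shows "closed_graph n E"
proof -
  have edge: "{p, q} \<in> E" if "{i, k} \<in> E" "i < k" "p \<in> {i..k}" "q \<in> {i..k}" "p \<noteq> q" for i k p q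
  proof -
    have "{i, k} \<in> [{1..n}]\<^bsup>2\<^esup>" using assms(1) that(1) unfolding graph_on_def by blast
    then have "{i, k} \<subseteq> {1..n}" by simp
    moreover have "clique {i, k} E" using that(1) by (simp add: clique_def insert_commute[of k i])
    ultimately obtain K where K: "{i, k} \<subseteq> K" "maximal_clique n E K"
      using ex_maximal_clique by meson
    with assms(2) obtain a b where "K = {a..b}"
      unfolding interval_labeled_def by blast
    with K(1) that have "p \<in> K" "q \<in> K" by auto
    with K(2) \<open>p \<noteq> q\<close> show ?thesis unfolding maximal_clique_def clique_def by blast
  qed
  have "{j, k} \<in> E" if "i < j" "j < k" "{i, k} \<in> E" for i j k
    by (rule edge[OF that(3)]) (use that(1,2) in simp_all)
  moreover have "{j, k} \<in> E" if "k < j" "j < i" "{i, k} \<in> E" for i j k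
  proof (rule edge)
    show "{k, i} \<in> E" using that(3) by (metis insert_commute)
  qed (use that(1,2) in simp_all)
  ultimately have "\<forall>i j k. (1 \<le> i \<and> i < j \<and> j < k \<and> k \<le> n \<or> 1 \<le> k \<and> k < j \<and> j < i \<and> i \<le> n) \<and>
      {id i, id j} \<in> E \<and> {id i, id k} \<in> E \<longrightarrow> {id j, id k} \<in> E"
    unfolding id_apply by blast
  then show ?thesis
    unfolding closed_graph_def by (intro exI[of _ id] conjI bij_betw_id)
qed

end

theory Submission
  imports Defs
begin

text \<open>
  Every edge of the associated graph arises from an edge \<open>{i, j}\<close> of \<open>G\<^sub>1\<close> and an edge \<open>{k, l}\<close> of
  \<open>G\<^sub>2\<close>, which lie in maximal cliques \<open>[a, b]\<close> and \<open>[c, d]\<close>. The interval \<open>[a + c - 1, b + d - 2]\<close>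
  then contains the edge, and it is a clique (\<open>clique_assoc_interval\<close>): the left ends
  \<open>i + k - 1\<close> and the right ends \<open>j + l - 2\<close> can be prescribed independently, because the sum of
  two integer intervals is again an interval. So every edge, together with all the vertices between
  its ends, lies in a clique of the required form.

  A maximal clique with at least two vertices lies between its least and its greatest vertex, which
  are joined by an edge; by maximality it equals the interval found for that edge. Cliques with at
  most one vertex are not maximal: connectedness of \<open>G\<^sub>1\<close> and \<open>G\<^sub>2\<close> makes all consecutive
  vertices adjacent in both graphs, hence also in the associated graph
  (\<open>consecutive_assoc_edge\<close>), and that graph has at least two vertices.
\<close>

lemma edge_in_maximal_interval:
  assumes "graph_on n E" and "interval_labeled n E" and "{i, j} \<in> E"
  obtains a b where "maximal_clique n E {a..b}" and "i \<in> {a..b}" and "j \<in> {a..b}"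
proof -
  have "{i, j} \<subseteq> {1..n}"
    using assms(1,3) unfolding graph_on_def nsets_def by blast
  moreover have "clique {i, j} E"
    using assms(3) by (simp add: clique_def insert_commute[of j i])
  ultimately obtain K where K: "{i, j} \<subseteq> K" "maximal_clique n E K"
    using ex_maximal_clique by meson
  with assms(2) obtain a b where "K = {a..b}"
    unfolding interval_labeled_def by blast
  with K that show thesis by simp
qed

text \<open>
  A path from \<open>1\<close> to \<open>n\<close> must use an edge that crosses the cut between \<open>i\<close> and \<open>i + 1\<close>; the maximal
  clique through that edge is an interval, so it contains both \<open>i\<close> and \<open>i + 1\<close>.
\<close>

lemma consecutive_edge:
  assumes "graph_on n E" and "connected_on n E" and "interval_labeled n E"
    and "1 \<le> i" and "i < n"
  shows "{i, Suc i} \<in> E"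
proof -
  have "\<exists>x y. {x, y} \<in> E \<and> x \<le> i \<and> i < y"
    if "(1, v) \<in> {(x, y). {x, y} \<in> E}\<^sup>*" and "i < v" for v
    using that
  proof (induction rule: rtrancl_induct)
    case base
    with assms(4) show ?case by simp
  next
    case (step y z)
    then show ?case by (cases "i < y") (blast, force)
  qed
  moreover have "(1, n) \<in> {(x, y). {x, y} \<in> E}\<^sup>*"
    using assms(2,4,5) unfolding connected_on_def by auto
  ultimately obtain x y where xy: "{x, y} \<in> E" "x \<le> i" "i < y"
    using assms(5) by blast
  from edge_in_maximal_interval[OF assms(1,3) xy(1)] obtain a b
    where "maximal_clique n E {a..b}" "x \<in> {a..b}" "y \<in> {a..b}" .
  moreover from this xy have "i \<in> {a..b}" "Suc i \<in> {a..b}" by auto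
  ultimately show ?thesis
    unfolding maximal_clique_def clique_def by (metis n_not_Suc_n)
qed

lemma sum_of_intervals:
  fixes s :: nat
  assumes "x \<le> y" and "z \<le> w" and "x + z \<le> s" and "s \<le> y + w"
  obtains p q where "p \<in> {x..y}" and "q \<in> {z..w}" and "p + q = s"
proof
  show "min y (s - z) \<in> {x..y}" and "s - min y (s - z) \<in> {z..w}"
    and "min y (s - z) + (s - min y (s - z)) = s"
    using assms by auto
qed

lemma clique_assoc_interval:
  assumes "clique {a..b} E1" and "clique {c..d} E2" and "a < b" and "c < d"
  shows "clique {a + c - 1..b + d - 2} (assoc_edges E1 E2)"
proof -
  have edge: "{u, v} \<in> assoc_edges E1 E2"
    if uv: "a + c - 1 \<le> u" "u < v" "v \<le> b + d - 2" for u v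
  proof -
    \<comment> \<open>The left ends stay below \<open>b\<close> and \<open>d\<close>, so that there is room for larger right ends.\<close>
    obtain i k where ik: "i \<in> {a..b - 1}" "k \<in> {c..d - 1}" "i + k = u + 1"
      by (rule sum_of_intervals[of a "b - 1" c "d - 1" "u + 1"]) (use assms uv in linarith)+
    obtain j l where jl: "j \<in> {Suc i..b}" "l \<in> {Suc k..d}" "j + l = v + 2"
      by (rule sum_of_intervals[of "Suc i" b "Suc k" d "v + 2"]) (use assms uv ik in auto)
    have "{i, j} \<in> E1" "{k, l} \<in> E2"
      using assms ik jl unfolding clique_def by auto
    moreover have "i < j" "k < l" "u = i + k - 1" "v = j + l - 2"
      using ik jl by auto
    ultimately show ?thesis unfolding assoc_edges_def by blast
  qed
  show ?thesis
    unfolding clique_def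
  proof (intro ballI impI)
    fix u v
    assume "u \<in> {a + c - 1..b + d - 2}" "v \<in> {a + c - 1..b + d - 2}" "u \<noteq> v"
    then show "{u, v} \<in> assoc_edges E1 E2"
      using edge[of u v] edge[of v u] by (cases "u < v") (auto simp: insert_commute[of u v])
  qed
qed

lemma consecutive_assoc_edge:
  assumes "\<And>i. 1 \<le> i \<Longrightarrow> i < m \<Longrightarrow> {i, Suc i} \<in> E1"
    and "\<And>k. 1 \<le> k \<Longrightarrow> k < n \<Longrightarrow> {k, Suc k} \<in> E2"
    and "2 \<le> m" and "2 \<le> n" and "1 \<le> u" and "u < m + n - 2"
  shows "{u, Suc u} \<in> assoc_edges E1 E2"
proof -
  obtain i k where ik: "i \<in> {1..m - 1}" "k \<in> {1..n - 1}" "i + k = u + 1"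
    by (rule sum_of_intervals[of 1 "m - 1" 1 "n - 1" "u + 1"]) (use assms in linarith)+
  then have "{i, Suc i} \<in> E1" "{k, Suc k} \<in> E2"
    using assms by auto
  moreover have "{u, Suc u} = {i + k - 1, Suc i + Suc k - 2}"
    using ik by auto
  ultimately show ?thesis
    unfolding assoc_edges_def using lessI by blast
qed

lemma assoc_edge_in_product_interval:
  assumes "graph_on m E1" and "interval_labeled m E1"
    and "graph_on n E2" and "interval_labeled n E2"
    and "{u, v} \<in> assoc_edges E1 E2"
  obtains a b c d where "maximal_clique m E1 {a..b}" and "maximal_clique n E2 {c..d}"
    and "a < b" and "c < d" and "{u, v} \<subseteq> {a + c - 1..b + d - 2}"
proof -
  from assms(5) obtain i j k l where e: "{u, v} = {i + k - 1, j + l - 2}"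
    "i < j" "k < l" "{i, j} \<in> E1" "{k, l} \<in> E2"
    unfolding assoc_edges_def by blast
  obtain a b where ab: "maximal_clique m E1 {a..b}" "i \<in> {a..b}" "j \<in> {a..b}"
    using edge_in_maximal_interval[OF assms(1,2) e(4)] .
  obtain c d where cd: "maximal_clique n E2 {c..d}" "k \<in> {c..d}" "l \<in> {c..d}"
    using edge_in_maximal_interval[OF assms(3,4) e(5)] .
  have "{u, v} \<subseteq> {a + c - 1..b + d - 2}"
    unfolding e(1) using e(2,3) ab cd by auto
  moreover have "a < b" "c < d"
    using e(2,3) ab cd by auto
  ultimately show thesis using that ab(1) cd(1) by blast
qed

theorem proposition2p1:
  fixes m n :: nat and E1 E2 :: "nat set set"
  assumes "m \<ge> 2" and "n \<ge> 2"
    and "graph_on m E1" and "connected_on m E1" and "closed_graph m E1" and "interval_labeled m E1"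
    and "graph_on n E2" and "connected_on n E2" and "closed_graph n E2" and "interval_labeled n E2"
  shows "\<forall>K. maximal_clique (m + n - 2) (assoc_edges E1 E2) K \<longrightarrow>
           (\<exists>a b c d. maximal_clique m E1 {a..b} \<and> maximal_clique n E2 {c..d} \<and>
              K = {a + c - 1..b + d - 2})"
proof (intro allI impI)
  fix K
  let ?N = "m + n - 2" and ?E = "assoc_edges E1 E2"
  assume "maximal_clique ?N ?E K"
  then have K: "K \<subseteq> {1..?N}" "clique K ?E"
    and max: "\<And>K'. K \<subseteq> K' \<Longrightarrow> K' \<subseteq> {1..?N} \<Longrightarrow> clique K' ?E \<Longrightarrow> K' = K"
    unfolding maximal_clique_def by blast+
  have "finite K" using K(1) finite_subset by blast
  have "\<exists>u v. {u, v} \<in> ?E \<and> K \<subseteq> {u..v}"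
  proof (cases "\<exists>w. K \<subseteq> {w}")
    case True
    have "K \<subseteq> {u..Suc u}" if "w \<in> {u..Suc u}" "K \<subseteq> {w}" for u w
      using that by blast
    moreover have "\<exists>u w. 1 \<le> u \<and> u < ?N \<and> w \<in> {u..Suc u} \<and> K \<subseteq> {w}"
    proof (cases "K \<subseteq> {?N}")
      case True
      with assms(1,2) show ?thesis
        by (intro exI[of _ "?N - 1"] exI[of _ ?N]) auto
    next
      case False
      with True K(1) obtain w where "K = {w}" "1 \<le> w" "w < ?N"
        by (fastforce simp: subset_singleton_iff)
      then show ?thesis by (intro exI[of _ w]) auto
    qed
    moreover have "{u, Suc u} \<in> ?E" if "1 \<le> u" "u < ?N" for u
      using consecutive_assoc_edge[OF consecutive_edge[OF assms(3,4,6)]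
          consecutive_edge[OF assms(7,8,10)] assms(1,2) that] .
    ultimately show ?thesis by blast
  next
    case False
    then have "K \<noteq> {}" by blast
    with \<open>finite K\<close> have mm: "Min K \<in> K" "Max K \<in> K" "K \<subseteq> {Min K..Max K}"
      by auto
    with False have "Min K \<noteq> Max K" by (metis atLeastAtMost_singleton)
    with K(2) mm have "{Min K, Max K} \<in> ?E" unfolding clique_def by blast
    with mm(3) show ?thesis by blast
  qed
  then obtain u v where uv: "{u, v} \<in> ?E" "K \<subseteq> {u..v}" by blast
  obtain a b c d where
    abcd: "maximal_clique m E1 {a..b}" "maximal_clique n E2 {c..d}" "a < b" "c < d"
    and sub: "{u, v} \<subseteq> {a + c - 1..b + d - 2}"
    using assoc_edge_in_product_interval[OF assms(3,6,7,10) uv(1)] .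
  have "{a..b} \<subseteq> {1..m}" "{c..d} \<subseteq> {1..n}"
    using abcd(1,2) unfolding maximal_clique_def by blast+
  then have "{a + c - 1..b + d - 2} \<subseteq> {1..?N}"
    using abcd(3,4) by auto
  moreover have "clique {a + c - 1..b + d - 2} ?E"
    using abcd unfolding maximal_clique_def by (intro clique_assoc_interval) blast+
  moreover have "K \<subseteq> {a + c - 1..b + d - 2}"
    using uv(2) sub by force
  ultimately have "K = {a + c - 1..b + d - 2}"
    using max by metis
  with abcd(1,2) show "\<exists>a b c d. maximal_clique m E1 {a..b} \<and> maximal_clique n E2 {c..d} \<and>
      K = {a + c - 1..b + d - 2}"
    by blast
qed

end
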